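(* Let $k$ be an autoconvolution kernel as in the context, let $g^\dagger,g^\delta\in L^2_{\mathbb C}([0,2])$ with $\|g^\delta-g^\dagger\|\le\delta$, let $\alpha>0$, and let $u^\dagger\in L^2_{\mathbb C}([0,1])$ be a norm-minimizing solution of the kernel-based deautoconvolution problem $\mathcal A_k[u]=g^\dagger$. Suppose there exists $\phi\in L^2_{\mathbb C}([0,2])$ such that the integral operator $$\Phi_{\mathcal I_k^*[\phi]}[u](t):=\int_0^1\overline{k(s,s+t)}\,\phi(s+t)\,\overline{u(s)}\,\mathrm ds\qquad(t\in[0,1])$$ on $L^2_{\mathbb C}([0,1])$ satisfies $\|\Phi_{\mathcal I_k^*[\phi]}\|=1$ and $\Phi_{\mathcal I_k^*[\phi]}[u^\dagger]=u^\dagger$. Then every minimizer $u_\alpha^\delta$ of the Tikhonov functional $$J_\alpha(u):=\|\mathcal A_k[u]-g^\delta\|^2+\alpha\|u\|^2\qquad(u\in L^2_{\mathbb C}([0,1]))$$ satisfies $$\Delta_{\beta,(0,\Phi_{\mathcal I_k^*[\phi]})}(u_\alpha^\delta,u^\dagger)\le\Bigl(\tfrac{\delta}{\sqrt\alpha}+\tfrac{\sqrt\alpha}{2}\|\phi\|\Bigr)^2 \qquad\text{and}\qquad \|\mathcal A_k[u_\alpha^\delta]-g^\delta\|\le\delta+\alpha\|\phi\|,$$ where $\Delta_\beta$ is the dilinear Bregman distance with respect to the squared norm of $L^2_{\mathbb C}([0,1])$.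
   Context: $L^2_{\mathbb C}([0,1])$ and $L^2_{\mathbb C}([0,2])$ denote the complex-valued square-integrable functions, regarded as real Hilbert spaces with inner product $\langle\cdot,\cdot\rangle_{\mathbb R}=\operatorname{Re}\langle\cdot,\cdot\rangle_{\mathbb C}$; functions are extended by zero outside their interval. Kernel: $k\in L^\infty_{\mathbb C}([0,1]\times[0,2])$ with $\operatorname{supp}k\subset\{(s,t):0\le s\le1,\ s\le t\le s+1\}$ and $k(s,t)=k(t-s,t)$ for $0\le s\le1$, $s\le t\le s+1$. The kernel-based autoconvolution is $\mathcal A_k\colon L^2_{\mathbb C}([0,1])\to L^2_{\mathbb C}([0,2])$, $\mathcal A_k[u](t)=\int_{-\infty}^\infty k(s,t)\,u(s)\,u(t-s)\,\mathrm ds$. A norm-minimizing solution of $\mathcal A_k[u]=g^\dagger$ is a solution $u^\dagger$ with $\|u^\dagger\|\le\|u\|$ for all solutions $u$. For a real Hilbert space $H$, $H\otimes_{\pi,\mathrm{sym}}H$ is the closed subspace of the projective tensor product $H\otimes_\pi H$ spanned by the tensors $u\otimes u$; its dual is identified with the self-adjoint bounded ($\mathbb R$-)linear operators $\Phi$ on $H$, acting by $\langle\Phi,u\otimes u\rangle=\langle\Phi[u],u\rangle_H$. A pair $(\xi,\Xi)\in H\times(H\otimes_{\pi,\mathrm{sym}}H)^*$ is a dilinear subgradient of $F\colon H\to\overline{\mathbb R}$ at $u$ if $F(u)$ is finite and $F(v)\ge F(u)+\langle\xi,v-u\rangle+\langle\Xi,v\otimes v-u\otimes u\rangle$ for all $v\in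 H$; the associated dilinear Bregman distance is $\Delta_{\beta,(\xi,\Xi)}(v,u):=F(v)-F(u)-\langle\xi,v-u\rangle-\langle\Xi,v\otimes v-u\otimes u\rangle$. Thus here $\Delta_{\beta,(0,\Phi)}(v,u^\dagger)=\|v\|^2-\|u^\dagger\|^2-\langle\Phi[v],v\rangle_{\mathbb R}+\langle\Phi[u^\dagger],u^\dagger\rangle_{\mathbb R}$. *)

theory Defs
  imports "HOL-Analysis.Analysis"
begin

text \<open>
  A class in \<open>L\<^sup>2(S)\<close> is represented by a Borel function on the whole line that
  vanishes identically outside \<open>S\<close> (extension by zero); every class has such a
  representative. Equality of classes is \<open>=\<^sub>L\<close>. Norms, inner products and the integral
  operators below depend only on the classes of their arguments.
\<close>

definition L2 :: "real set \<Rightarrow> (real \<Rightarrow> complex) set" where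
  "L2 S = {u \<in> borel_measurable borel.
             integrable lborel (\<lambda>t. (norm (u t))\<^sup>2) \<and> (\<forall>t. t \<notin> S \<longrightarrow> u t = 0)}"

definition L2_eq :: "(real \<Rightarrow> complex) \<Rightarrow> (real \<Rightarrow> complex) \<Rightarrow> bool" (infix "=\<^sub>L" 50) where
  "u =\<^sub>L v \<longleftrightarrow> (AE t in lborel. u t = v t)"

definition L2_norm :: "(real \<Rightarrow> complex) \<Rightarrow> real" where
  "L2_norm u = sqrt (LINT t|lborel. (norm (u t))\<^sup>2)"

definition L2_inner :: "(real \<Rightarrow> complex) \<Rightarrow> (real \<Rightarrow> complex) \<Rightarrow> real" where
  "L2_inner u v = Re (LINT t|lborel. u t * cnj (v t))"

text \<open>
  As in \<^const>\<open>onorm\<close>, the quotient is \<open>0\<close> for \<open>u = 0\<close>. The supremum is meaningful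
  only for bounded operators.
\<close>

definition L2_onorm :: "real set \<Rightarrow> ((real \<Rightarrow> complex) \<Rightarrow> (real \<Rightarrow> complex)) \<Rightarrow> real" where
  "L2_onorm S T = (SUP u \<in> L2 S. L2_norm (T u) / L2_norm u)"

text \<open>
  The kernel is likewise a representative, extended by zero to the plane, of a class in
  \<open>L\<^sup>\<infinity>\<close>; hence boundedness, support and symmetry are required almost everywhere. As the
  strip is closed, the support of a class lies in it iff the class vanishes almost
  everywhere off it.
\<close>

definition kernel_strip :: "(real \<times> real) set" where
  "kernel_strip = {(s, t). 0 \<le> s \<and> s \<le> 1 \<and> s \<le> t \<and> t \<le> s + 1}"

definition autoconv_kernel :: "(real \<Rightarrow> real \<Rightarrow> complex) \<Rightarrow> bool" where
  "autoconv_kernel k \<longleftrightarrow>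
     (\<lambda>(s, t). k s t) \<in> borel_measurable borel \<and>
     (\<exists>C. AE (s, t) in lborel. norm (k s t) \<le> C) \<and>
     (AE (s, t) in lborel. (s, t) \<notin> kernel_strip \<longrightarrow> k s t = 0) \<and>
     (AE (s, t) in lborel. (s, t) \<in> kernel_strip \<longrightarrow> k s t = k (t - s) t)"

definition autoconv :: "(real \<Rightarrow> real \<Rightarrow> complex) \<Rightarrow> (real \<Rightarrow> complex) \<Rightarrow> (real \<Rightarrow> complex)" where
  "autoconv k u t = (LINT s|lborel. k s t * u s * u (t - s))"

definition norm_minimizing_solution ::
    "(real \<Rightarrow> real \<Rightarrow> complex) \<Rightarrow> (real \<Rightarrow> complex) \<Rightarrow> (real \<Rightarrow> complex) \<Rightarrow> bool" where
  "norm_minimizing_solution k g u \<longleftrightarrow>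
     is_arg_min L2_norm (\<lambda>v. v \<in> L2 {0..1} \<and> autoconv k v =\<^sub>L g) u"

definition Phi_op ::
    "(real \<Rightarrow> real \<Rightarrow> complex) \<Rightarrow> (real \<Rightarrow> complex) \<Rightarrow> (real \<Rightarrow> complex) \<Rightarrow> (real \<Rightarrow> complex)" where
  "Phi_op k \<phi> u t =
     (if t \<in> {0..1}
      then LINT s:{0..1}|lborel. cnj (k s (s + t)) * \<phi> (s + t) * cnj (u s)
      else 0)"

definition tikhonov ::
    "(real \<Rightarrow> real \<Rightarrow> complex) \<Rightarrow> (real \<Rightarrow> complex) \<Rightarrow> real \<Rightarrow> (real \<Rightarrow> complex) \<Rightarrow> real" where
  "tikhonov k g \<alpha> u = (L2_norm (autoconv k u - g))\<^sup>2 + \<alpha> * (L2_norm u)\<^sup>2"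

text \<open>
  The dilinear Bregman distance of a finite functional \<open>F\<close>; an element of the dual of the
  symmetric projective tensor product is given as a self-adjoint bounded real-linear
  operator \<open>\<Xi>\<close>, whose pairing with \<open>v \<otimes> v\<close> is the inner product of \<open>\<Xi> v\<close> and \<open>v\<close>.
\<close>

definition dilinear_bregman ::
    "((real \<Rightarrow> complex) \<Rightarrow> real) \<Rightarrow> (real \<Rightarrow> complex) \<Rightarrow> ((real \<Rightarrow> complex) \<Rightarrow> (real \<Rightarrow> complex))
      \<Rightarrow> (real \<Rightarrow> complex) \<Rightarrow> (real \<Rightarrow> complex) \<Rightarrow> real" where
  "dilinear_bregman F \<xi> \<Xi> v u =
     F v - F u - L2_inner \<xi> (v - u) - (L2_inner (\<Xi> v) v - L2_inner (\<Xi> u) u)"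

end

theory Submission
  imports Defs
begin

text \<open>
  By Fubini and the shear \<open>(s, t) \<mapsto> (s, s + t)\<close>, the quadratic form of \<open>\<Phi>\<close> is dual to the
  autoconvolution: \<open>\<langle>\<Phi> u, u\<rangle> = \<langle>\<phi>, A u\<rangle>\<close>. Hence the Bregman distance \<open>D\<close> equals
  \<open>\<parallel>u\<^sub>\<alpha>\<parallel>\<^sup>2 - \<parallel>u\<^sub>0\<parallel>\<^sup>2 - \<langle>\<phi>, A u\<^sub>\<alpha> - g\<rangle>\<close>. Comparing the Tikhonov values at \<open>u\<^sub>\<alpha>\<close> and \<open>u\<^sub>0\<close>
  and writing \<open>r = \<parallel>A u\<^sub>\<alpha> - g\<^sup>\<delta>\<parallel>\<close>, \<open>p = \<parallel>\<phi>\<parallel>\<close>, the Cauchy-Schwarz inequality gives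
  \<open>\<alpha> D \<le> \<delta>\<^sup>2 - r\<^sup>2 + \<alpha> p (r + \<delta>) = (\<delta> + \<alpha> p / 2)\<^sup>2 - (r - \<alpha> p / 2)\<^sup>2\<close>.
  Dropping the last square yields the first estimate. For the second one, \<open>D \<ge> 0\<close> because
  \<open>\<parallel>\<Phi>\<parallel> = 1\<close> and \<open>\<Phi> u\<^sub>0 = u\<^sub>0\<close>.
\<close>

section \<open>Norm and inner product of square-integrable functions\<close>

lemma borel_measurable_cnj [measurable (raw)]:
  "f \<in> borel_measurable M \<Longrightarrow> (\<lambda>x. cnj (f x)) \<in> borel_measurable M"
  by (rule borel_measurable_continuous_on[OF continuous_on_cnj]) auto

lemma borel_measurable_L2: "u \<in> L2 S \<Longrightarrow> u \<in> borel_measurable borel"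
  by (simp add: L2_def)

lemma integrable_L2: "u \<in> L2 S \<Longrightarrow> integrable lborel (\<lambda>t. (norm (u t))\<^sup>2)"
  by (simp add: L2_def)

lemma L2_outside: "u \<in> L2 S \<Longrightarrow> t \<notin> S \<Longrightarrow> u t = 0"
  by (simp add: L2_def)

lemma L2_norm_nonneg: "0 \<le> L2_norm u"
  by (simp add: L2_norm_def)

lemma L2_norm_sq: "(L2_norm u)\<^sup>2 = (LINT t|lborel. (norm (u t))\<^sup>2)"
  by (simp add: L2_norm_def)

lemma L2_norm_cong_AE:
  assumes "u \<in> borel_measurable borel" "v \<in> borel_measurable borel"
    and "AE t in lborel. norm (u t) = norm (v t)"
  shows "L2_norm u = L2_norm v"
  unfolding L2_norm_def using assms
  by (intro arg_cong[where f = sqrt] integral_cong_AE) auto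

lemma L2_norm_zero_AE:
  assumes "u \<in> L2 S" "L2_norm u = 0"
  shows "AE t in lborel. u t = 0"
proof -
  have "(LINT t|lborel. (norm (u t))\<^sup>2) = 0"
    using assms(2) L2_norm_sq[of u] by simp
  then show ?thesis
    using integral_nonneg_eq_0_iff_AE[OF integrable_L2[OF assms(1)]] by simp
qed

lemma integrable_norm_mult_L2:
  assumes "u \<in> L2 S" "v \<in> L2 T"
  shows "integrable lborel (\<lambda>t. norm (u t) * norm (v t))"
proof (rule Bochner_Integration.integrable_bound)
  show "integrable lborel (\<lambda>t. (norm (u t))\<^sup>2 + (norm (v t))\<^sup>2)"
    using assms by (intro Bochner_Integration.integrable_add integrable_L2)
  show "(\<lambda>t. norm (u t) * norm (v t)) \<in> borel_measurable lborel"
    using assms[THEN borel_measurable_L2] by simp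
  have "x * y \<le> x\<^sup>2 + y\<^sup>2" for x y :: real
    using sum_squares_bound[of x y] zero_le_power2[of x] zero_le_power2[of y] by linarith
  then show "AE t in lborel. norm (norm (u t) * norm (v t)) \<le> norm ((norm (u t))\<^sup>2 + (norm (v t))\<^sup>2)"
    by auto
qed

lemma integrable_mult_L2:
  assumes "u \<in> L2 S" "v \<in> L2 T"
  shows "integrable lborel (\<lambda>t. u t * v t)"
  using integrable_norm_mult_L2[OF assms] assms[THEN borel_measurable_L2]
  by (subst integrable_norm_iff[symmetric]) (auto simp: norm_mult)

text \<open>The integral of the square of \<open>?b * norm (u t) - ?a * norm (v t)\<close> is
  nonnegative and expands to \<open>2 * (?a * ?b) * (?a * ?b - ?I)\<close>; for positive norms the
  first factor cancels. If a norm is zero, the integrand vanishes almost everywhere.\<close>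

lemma L2_Cauchy_Schwarz:
  assumes u: "u \<in> L2 S" and v: "v \<in> L2 T"
  shows "(LINT t|lborel. norm (u t) * norm (v t)) \<le> L2_norm u * L2_norm v" (is "?I \<le> ?a * ?b")
proof (cases "?a = 0 \<or> ?b = 0")
  case True
  then have "AE t in lborel. norm (u t) * norm (v t) = 0"
    using L2_norm_zero_AE[OF u] L2_norm_zero_AE[OF v] by (auto elim: eventually_mono)
  then show ?thesis
    using True by (auto simp: integral_eq_zero_AE)
next
  case False
  then have pos: "?a > 0" "?b > 0"
    using L2_norm_nonneg[of u] L2_norm_nonneg[of v] by auto
  have "0 \<le> (LINT t|lborel. (?b * norm (u t) - ?a * norm (v t))\<^sup>2)"
    by simp
  also have "\<dots> = (LINT t|lborel. ?b\<^sup>2 * (norm (u t))\<^sup>2 + ?a\<^sup>2 * (norm (v t))\<^sup>2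
      - 2 * ?a * ?b * (norm (u t) * norm (v t)))"
    by (intro Bochner_Integration.integral_cong) (auto simp: power2_eq_square algebra_simps)
  also have "\<dots> = 2 * (?a * ?b) * (?a * ?b - ?I)"
    using integrable_L2[OF u] integrable_L2[OF v] integrable_norm_mult_L2[OF u v]
    by (simp add: L2_norm_sq[symmetric]) (simp add: power2_eq_square algebra_simps)
  finally show ?thesis
    unfolding zero_le_mult_iff[of "2 * (?a * ?b)"] using mult_pos_pos[OF pos] by linarith
qed

lemma L2_inner_le_norm:
  assumes "u \<in> L2 S" "v \<in> L2 T"
  shows "\<bar>L2_inner u v\<bar> \<le> L2_norm u * L2_norm v"
proof -
  have "\<bar>L2_inner u v\<bar> \<le> norm (LINT t|lborel. u t * cnj (v t))"
    unfolding L2_inner_def by (rule abs_Re_le_cmod)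
  also have "\<dots> \<le> (LINT t|lborel. norm (u t * cnj (v t)))"
    by (rule integral_norm_bound)
  also have "\<dots> \<le> L2_norm u * L2_norm v"
    using L2_Cauchy_Schwarz[OF assms] by (simp add: norm_mult)
  finally show ?thesis .
qed

lemma L2_cnj: "u \<in> L2 S \<Longrightarrow> (\<lambda>t. cnj (u t)) \<in> L2 S"
  by (auto simp: L2_def intro: borel_measurable_cnj)

lemma L2_norm_cnj: "L2_norm (\<lambda>t. cnj (u t)) = L2_norm u"
  by (simp add: L2_norm_def)

lemma L2_diff:
  assumes u: "u \<in> L2 S" and v: "v \<in> L2 S"
  shows "u - v \<in> L2 S"
proof -
  have m: "u - v \<in> borel_measurable borel"
    using assms[THEN borel_measurable_L2] by (simp add: fun_diff_def)
  have "integrable lborel (\<lambda>t. (norm ((u - v) t))\<^sup>2)"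
  proof (rule Bochner_Integration.integrable_bound)
    show "integrable lborel (\<lambda>t. 2 * (norm (u t))\<^sup>2 + 2 * (norm (v t))\<^sup>2)"
      using assms by (intro Bochner_Integration.integrable_add integrable_mult_right integrable_L2)
    show "(\<lambda>t. (norm ((u - v) t))\<^sup>2) \<in> borel_measurable lborel"
      using m unfolding measurable_lborel1 by measurable
    have "(norm (a - b))\<^sup>2 \<le> 2 * (norm a)\<^sup>2 + 2 * (norm b)\<^sup>2" for a b :: complex
    proof -
      have "(norm (a - b))\<^sup>2 \<le> (norm a + norm b)\<^sup>2"
        by (intro power_mono norm_triangle_ineq4) simp
      also have "\<dots> \<le> 2 * (norm a)\<^sup>2 + 2 * (norm b)\<^sup>2"
        using sum_squares_bound[of "norm a" "norm b"] by (simp add: power2_sum)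
      finally show ?thesis .
    qed
    then show "AE t in lborel. norm ((norm ((u - v) t))\<^sup>2)
        \<le> norm (2 * (norm (u t))\<^sup>2 + 2 * (norm (v t))\<^sup>2)"
      by (auto simp: fun_diff_def)
  qed
  then show ?thesis
    using m u v by (auto simp: L2_def)
qed

lemma L2_inner_diff_right:
  assumes w: "w \<in> L2 R" and u: "u \<in> L2 S" and v: "v \<in> L2 T"
  shows "L2_inner w (u - v) = L2_inner w u - L2_inner w v"
  using integrable_mult_L2[OF w L2_cnj[OF u]] integrable_mult_L2[OF w L2_cnj[OF v]]
  by (simp add: L2_inner_def right_diff_distrib)

lemma L2_inner_self: "L2_inner u u = (L2_norm u)\<^sup>2"
  by (simp add: L2_inner_def L2_norm_sq complex_norm_square[symmetric] flip: of_real_power)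

section \<open>Affine substitutions, convolution integrals and essentially bounded functions\<close>

lemma L2_affine:
  fixes a c :: real
  assumes u: "u \<in> L2 S" and c: "\<bar>c\<bar> = 1"
  shows "(\<lambda>s. u (a + c * s)) \<in> L2 UNIV" and "L2_norm (\<lambda>s. u (a + c * s)) = L2_norm u"
proof -
  have c0: "c \<noteq> 0" using c by auto
  have [measurable]: "u \<in> borel_measurable borel"
    by (rule borel_measurable_L2[OF u])
  \<comment> \<open>The substitution moves the support, so the domain is relaxed to
    \<open>UNIV\<close>.\<close>
  show "(\<lambda>s. u (a + c * s)) \<in> L2 UNIV"
    using lborel_integrable_real_affine[OF integrable_L2[OF u] c0, of a]
    by (simp add: L2_def)
  show "L2_norm (\<lambda>s. u (a + c * s)) = L2_norm u"
    using lborel_integral_real_affine[OF c0, of "\<lambda>t. (norm (u t))\<^sup>2" a] c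
    by (simp add: L2_norm_def)
qed

text \<open>Cauchy-Schwarz against a translate or reflection of \<open>v\<close>, whose norm is that
  of \<open>v\<close>. The case \<open>c = -1\<close> serves the autoconvolution;
  \<open>c = 1\<close> serves \<open>Phi_op\<close> and the rows in the duality identity.\<close>

lemma L2_convolution:
  fixes a c :: real
  assumes u: "u \<in> L2 S" and v: "v \<in> L2 T" and c: "\<bar>c\<bar> = 1"
  shows "integrable lborel (\<lambda>s. u s * v (a + c * s))"
    and "(LINT s|lborel. norm (u s * v (a + c * s))) \<le> L2_norm u * L2_norm v"
  using integrable_mult_L2[OF u L2_affine(1)[OF v c]]
    L2_Cauchy_Schwarz[OF u L2_affine(1)[OF v c]] L2_affine(2)[OF v c]
  by (auto simp: norm_mult)

text \<open>This is how operator values are shown to be square-integrable: an almost-everywhere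
  bound is squared and integrated over an interval of finite length.\<close>

lemma L2_bounded_interval:
  fixes f :: "real \<Rightarrow> complex"
  assumes f: "f \<in> borel_measurable borel" "\<And>t. t \<notin> {a..b} \<Longrightarrow> f t = 0"
    and M: "0 \<le> M" "AE t in lborel. norm (f t) \<le> M" and ab: "a \<le> b"
  shows "f \<in> L2 {a..b}" and "L2_norm f \<le> M * sqrt (b - a)"
proof -
  have le: "AE t in lborel. (norm (f t))\<^sup>2 \<le> M\<^sup>2 * indicator {a..b} t"
    using M(2)
  proof eventually_elim
    case (elim t)
    then show ?case
      using f(2)[of t] power_mono[OF elim, of 2] by (auto simp: indicator_def)
  qed
  have bd: "integrable lborel (\<lambda>t. M\<^sup>2 * indicator {a..b} t :: real)"
    using ab by simp
  have int: "integrable lborel (\<lambda>t. (norm (f t))\<^sup>2)"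
  proof (rule Bochner_Integration.integrable_bound[OF bd])
    show "AE t in lborel. norm ((norm (f t))\<^sup>2) \<le> norm (M\<^sup>2 * indicator {a..b} t :: real)"
      using le by eventually_elim simp
  qed (use f in simp)
  then show "f \<in> L2 {a..b}"
    using f by (simp add: L2_def)
  have "(L2_norm f)\<^sup>2 \<le> (LINT t|lborel. M\<^sup>2 * indicator {a..b} t)"
    unfolding L2_norm_sq by (rule integral_mono_AE[OF int bd le])
  also have "\<dots> = (M * sqrt (b - a))\<^sup>2"
    using ab by (simp add: power_mult_distrib)
  finally show "L2_norm f \<le> M * sqrt (b - a)"
    by (rule power2_le_imp_le) (use M ab in simp)
qed

text \<open>Hoelder's inequality for an essentially bounded and an integrable factor. In the
  applications \<open>K\<close> is built from a section of the kernel and \<open>h\<close> is a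
  convolution integrand.\<close>

lemma integral_bounded_mult:
  fixes K h :: "real \<Rightarrow> complex"
  assumes K: "K \<in> borel_measurable borel" "AE s in lborel. norm (K s) \<le> C"
    and h: "integrable lborel h"
  shows "integrable lborel (\<lambda>s. K s * h s)"
    and "(LINT s|lborel. norm (K s * h s)) \<le> C * (LINT s|lborel. norm (h s))"
proof -
  have le: "AE s in lborel. norm (K s * h s) \<le> C * norm (h s)"
    using K(2) by eventually_elim (simp add: norm_mult mult_right_mono)
  have bd: "integrable lborel (\<lambda>s. C * norm (h s))"
    using h by simp
  show int: "integrable lborel (\<lambda>s. K s * h s)"
  proof (rule Bochner_Integration.integrable_bound[OF bd])
    show "AE s in lborel. norm (K s * h s) \<le> norm (C * norm (h s))"
      using le by eventually_elim simp
    show "(\<lambda>s. K s * h s) \<in> borel_measurable lborel"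
      using K(1) borel_measurable_integrable[OF h] by simp
  qed
  have "(LINT s|lborel. norm (K s * h s)) \<le> (LINT s|lborel. C * norm (h s))"
    by (rule integral_mono_AE[OF integrable_norm[OF int] bd le])
  then show "(LINT s|lborel. norm (K s * h s)) \<le> C * (LINT s|lborel. norm (h s))"
    by simp
qed

section \<open>Sections of the kernel and the autoconvolution\<close>

locale bounded_kernel =
  fixes k :: "real \<Rightarrow> real \<Rightarrow> complex" and C :: real
  assumes measurable_kernel: "(\<lambda>(s, t). k s t) \<in> borel_measurable borel"
    and AE_kernel_le: "AE (s, t) in lborel. norm (k s t) \<le> C"
    and bound_nonneg: "0 \<le> C"
begin

lemma measurable_kernel_comp [measurable (raw)]:
  assumes "f \<in> borel_measurable M" "h \<in> borel_measurable M"
  shows "(\<lambda>x. k (f x) (h x)) \<in> borel_measurable M"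
  using measurable_compose[OF borel_measurable_Pair[OF assms] measurable_kernel] by simp

lemma AE_kernel_row: "AE s in lborel. AE t in lborel. norm (k s t) \<le> C"
  using lborel_pair.AE_pair[of "\<lambda>(s, t). norm (k s t) \<le> C"] AE_kernel_le
  by (simp only: lborel_prod prod.case)

text \<open>The two almost-everywhere quantifiers are exchanged by Fubini, for which the set where
  the bound holds must be measurable in the plane.\<close>

lemma AE_kernel_column: "AE t in lborel. AE s in lborel. norm (k s t) \<le> C"
proof -
  have "{x \<in> space (lborel \<Otimes>\<^sub>M lborel). norm (k (fst x) (snd x)) \<le> C} \<in> sets (lborel \<Otimes>\<^sub>M lborel)"
    by measurable
  then show ?thesis
    using lborel_pair.AE_commute[of "\<lambda>s t. norm (k s t) \<le> C"] AE_kernel_row by blast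
qed

text \<open>For fixed \<open>s\<close>, adding \<open>s\<close> to \<open>t\<close> is a translation
  and preserves null sets, so the bound survives on almost every row. Exchanging quantifiers then
  gives the sections over which \<open>Phi_op\<close> integrates.\<close>

lemma AE_kernel_diagonal: "AE t in lborel. AE s in lborel. norm (k s (s + t)) \<le> C"
proof -
  have "AE s in lborel. AE t in lborel. norm (k s (s + t)) \<le> C"
    using AE_kernel_row
  proof eventually_elim
    case (elim s)
    then show ?case
      using AE_borel_affine[of 1 "\<lambda>t. norm (k s t) \<le> C" s] by simp
  qed
  moreover have "{x \<in> space (lborel \<Otimes>\<^sub>M lborel). norm (k (fst x) (fst x + snd x)) \<le> C}
      \<in> sets (lborel \<Otimes>\<^sub>M lborel)"
    by measurable
  ultimately show ?thesis
    using lborel_pair.AE_commute[of "\<lambda>s t. norm (k s (s + t)) \<le> C"] by blast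
qed

text \<open>On almost every column the convolution estimate bounds the value by
  \<open>C * (L2_norm u)\<^sup>2\<close>, and a bounded function on an interval of finite length is
  square-integrable.\<close>

lemma autoconv_L2:
  assumes u: "u \<in> L2 {0..1}"
  shows "autoconv k u \<in> L2 {0..2}"
proof (rule L2_bounded_interval)
  have [measurable]: "u \<in> borel_measurable borel"
    by (rule borel_measurable_L2[OF u])
  show "autoconv k u \<in> borel_measurable borel"
    unfolding autoconv_def by measurable
  show "autoconv k u t = 0" if "t \<notin> {0..2}" for t
  proof -
    \<comment> \<open>Since \<open>s\<close> and \<open>t - s\<close> add up to \<open>t\<close>,
      they cannot both lie in \<open>{0..1}\<close>.\<close>
    have zero: "k s t * u s * u (t - s) = 0" for s
      using that L2_outside[OF u, of s] L2_outside[OF u, of "t - s"]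
      by (cases "s \<in> {0..1}"; cases "t - s \<in> {0..1}") auto
    show ?thesis unfolding autoconv_def zero by simp
  qed
  show "0 \<le> C * (L2_norm u)\<^sup>2"
    using bound_nonneg by simp
  show "AE t in lborel. norm (autoconv k u t) \<le> C * (L2_norm u)\<^sup>2"
    using AE_kernel_column
  proof eventually_elim
    case (elim t)
    have "norm (autoconv k u t) \<le> (LINT s|lborel. norm (k s t * (u s * u (t + - 1 * s))))"
      unfolding autoconv_def by (simp add: mult.assoc integral_norm_bound)
    also have "\<dots> \<le> C * (LINT s|lborel. norm (u s * u (t + - 1 * s)))"
      by (intro integral_bounded_mult(2) elim L2_convolution(1)[OF u u]) auto
    also have "\<dots> \<le> C * (L2_norm u)\<^sup>2"
      using L2_convolution(2)[OF u u, of "-1" t] bound_nonneg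
      by (intro mult_left_mono) (auto simp: power2_eq_square)
    finally show ?case .
  qed
qed simp

section \<open>The operator \<open>Phi_op\<close>: boundedness and duality with the
  autoconvolution\<close>

lemma Phi_op_eq:
  assumes "u \<in> L2 {0..1}" "t \<in> {0..1}"
  shows "Phi_op k \<phi> u t = (LINT s|lborel. cnj (k s (s + t)) * \<phi> (s + t) * cnj (u s))"
  using assms(2) L2_outside[OF assms(1)] unfolding Phi_op_def set_lebesgue_integral_def
  by (auto intro!: Bochner_Integration.integral_cong simp: indicator_def)

text \<open>Without this bound the supremum in \<^const>\<open>L2_onorm\<close> could be a junk value.\<close>

lemma
  assumes u: "u \<in> L2 {0..1}" and \<phi>: "\<phi> \<in> L2 {0..2}"
  shows Phi_op_L2: "Phi_op k \<phi> u \<in> L2 {0..1}"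
    and Phi_op_bounded: "L2_norm (Phi_op k \<phi> u) \<le> C * L2_norm \<phi> * L2_norm u"
proof -
  have [measurable]: "u \<in> borel_measurable borel" "\<phi> \<in> borel_measurable borel"
    using u \<phi> by (auto dest: borel_measurable_L2)
  let ?M = "C * L2_norm \<phi> * L2_norm u"
  have meas: "Phi_op k \<phi> u \<in> borel_measurable borel"
    unfolding Phi_op_def[abs_def] set_lebesgue_integral_def by measurable
  have M: "0 \<le> ?M"
    using bound_nonneg by (simp add: L2_norm_nonneg)
  have outside: "Phi_op k \<phi> u t = 0" if "t \<notin> {0..1}" for t
    using that by (auto simp: Phi_op_def)
  have bound: "AE t in lborel. norm (Phi_op k \<phi> u t) \<le> ?M"
    using AE_kernel_diagonal
  proof eventually_elim
    case (elim t)
    show ?case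
    proof (cases "t \<in> {0..1}")
      case True
      have "norm (Phi_op k \<phi> u t)
          \<le> (LINT s|lborel. norm (cnj (k s (s + t)) * (cnj (u s) * \<phi> (t + 1 * s))))"
        unfolding Phi_op_eq[OF u True] by (simp add: mult_ac add.commute integral_norm_bound)
      also have "\<dots> \<le> C * (LINT s|lborel. norm (cnj (u s) * \<phi> (t + 1 * s)))"
        using elim by (intro integral_bounded_mult(2) L2_convolution(1)[OF L2_cnj[OF u] \<phi>]) auto
      also have "\<dots> \<le> C * (L2_norm u * L2_norm \<phi>)"
        using L2_convolution(2)[OF L2_cnj[OF u] \<phi>, of 1 t] bound_nonneg
        by (intro mult_left_mono) (auto simp: L2_norm_cnj)
      finally show ?thesis by (simp add: mult_ac)
    qed (use M outside in simp)
  qed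
  show "Phi_op k \<phi> u \<in> L2 {0..1}"
    by (rule L2_bounded_interval(1)[OF meas outside M bound]) auto
  \<comment> \<open>The interval has length one, so no further constant enters.\<close>
  have "L2_norm (Phi_op k \<phi> u) \<le> ?M * sqrt (1 - 0)"
    by (rule L2_bounded_interval(2)[OF meas outside M bound]) auto
  then show "L2_norm (Phi_op k \<phi> u) \<le> ?M"
    by simp
qed

lemma L2_norm_Phi_op_le:
  assumes u: "u \<in> L2 {0..1}" and \<phi>: "\<phi> \<in> L2 {0..2}"
  shows "L2_norm (Phi_op k \<phi> u) \<le> L2_onorm {0..1} (Phi_op k \<phi>) * L2_norm u"
proof (cases "L2_norm u = 0")
  \<comment> \<open>At norm zero the quotient in \<open>L2_onorm\<close> is \<open>0\<close> by
    convention and carries no information; the explicit bound with \<open>C\<close> forces the image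
    to have norm zero.\<close>
  case True
  then show ?thesis
    using Phi_op_bounded[OF u \<phi>] by simp
next
  case False
  have "bdd_above ((\<lambda>u. L2_norm (Phi_op k \<phi> u) / L2_norm u) ` L2 {0..1})"
  proof (rule bdd_aboveI2)
    fix v assume v: "v \<in> L2 {0..1}"
    show "L2_norm (Phi_op k \<phi> v) / L2_norm v \<le> C * L2_norm \<phi>"
      using Phi_op_bounded[OF v \<phi>] L2_norm_nonneg[of v] L2_norm_nonneg[of \<phi>] bound_nonneg
      by (cases "L2_norm v = 0") (auto simp: divide_le_eq)
  qed
  then have "L2_norm (Phi_op k \<phi> u) / L2_norm u \<le> L2_onorm {0..1} (Phi_op k \<phi>)"
    unfolding L2_onorm_def by (intro cSUP_upper u)
  then show ?thesis
    using False L2_norm_nonneg[of u] by (simp add: divide_le_eq)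
qed

text \<open>Both sides are iterated integrals of one function \<open>H\<close> on the plane: the
  right one over \<open>(s, t)\<close>, the left one over the sheared points
  \<open>(s, s + t)\<close>, where \<open>u (t - s)\<close> becomes \<open>u t\<close>. The main
  work is the absolute integrability that Fubini requires.\<close>

lemma L2_inner_Phi_op:
  assumes u: "u \<in> L2 {0..1}" and \<phi>: "\<phi> \<in> L2 {0..2}"
  shows "L2_inner (Phi_op k \<phi> u) u = L2_inner \<phi> (autoconv k u)"
proof -
  have [measurable]: "u \<in> borel_measurable borel" "\<phi> \<in> borel_measurable borel"
    using u \<phi> by (auto dest: borel_measurable_L2)
  define H where "H s t = \<phi> t * cnj (k s t * u s * u (t - s))" for s t
  have [measurable]: "(\<lambda>x. H (fst x) (snd x)) \<in> borel_measurable (borel \<Otimes>\<^sub>M borel)"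
    unfolding H_def by measurable
  \<comment> \<open>Pairing with the indicator of an interval of finite length shows that
    \<open>u\<close> is integrable, which makes the row bound below integrable in
    \<open>s\<close>.\<close>
  have "indicator {0..1} \<in> L2 {0..1}"
    by (rule L2_bounded_interval(1)[where M = 1]) (auto simp: indicator_def)
  then have "integrable lborel (\<lambda>s. u s * indicator {0..1} s)"
    by (rule integrable_mult_L2[OF u])
  moreover have "(\<lambda>s. u s * indicator {0..1} s) = u"
    using L2_outside[OF u] by (auto simp: indicator_def fun_eq_iff)
  ultimately have int_u: "integrable lborel u"
    by simp
  \<comment> \<open>With \<open>s\<close> fixed, \<open>u s\<close> is a constant and joins the
    kernel as the bounded factor; what remains is the product of \<open>\<phi>\<close> and a
    conjugated translate of \<open>u\<close>.\<close>
  have row: "AE s in lborel. integrable lborel (H s) \<and>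
      (LINT t|lborel. norm (H s t)) \<le> C * L2_norm \<phi> * L2_norm u * norm (u s)"
    using AE_kernel_row
  proof eventually_elim
    case (elim s)
    have H: "H s = (\<lambda>t. (cnj (u s) * cnj (k s t)) * (\<phi> t * cnj (u (- s + 1 * t))))"
      by (simp add: H_def fun_eq_iff mult_ac)
    have K: "AE t in lborel. norm (cnj (u s) * cnj (k s t)) \<le> norm (u s) * C"
      using elim by eventually_elim (simp add: norm_mult mult_left_mono)
    note conv = L2_convolution[OF \<phi> L2_cnj[OF u], of 1 "- s"]
    have "(LINT t|lborel. norm (H s t))
        \<le> norm (u s) * C * (LINT t|lborel. norm (\<phi> t * cnj (u (- s + 1 * t))))"
      unfolding H by (intro integral_bounded_mult(2) K conv(1)) auto
    also have "\<dots> \<le> norm (u s) * C * (L2_norm \<phi> * L2_norm u)"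
      using conv(2) bound_nonneg by (intro mult_left_mono) (auto simp: L2_norm_cnj)
    finally have "(LINT t|lborel. norm (H s t)) \<le> C * L2_norm \<phi> * L2_norm u * norm (u s)"
      by (simp add: mult_ac)
    moreover have "integrable lborel (H s)"
      unfolding H by (intro integral_bounded_mult(1)[OF _ K] conv(1)) auto
    ultimately show ?case by simp
  qed
  have outer: "integrable lborel (\<lambda>s. LINT t|lborel. norm (H s t))"
  proof (rule Bochner_Integration.integrable_bound)
    show "integrable lborel (\<lambda>s. C * L2_norm \<phi> * L2_norm u * norm (u s))"
      using int_u by simp
    show "AE s in lborel. norm (LINT t|lborel. norm (H s t))
        \<le> norm (C * L2_norm \<phi> * L2_norm u * norm (u s))"
      using row by eventually_elim auto
  qed measurable
  have int_H: "integrable (lborel \<Otimes>\<^sub>M lborel) (\<lambda>(s, t). H s t)"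
    using outer row by (intro lborel_pair.Fubini_integrable) (auto simp: case_prod_beta)
  have shift: "(LINT t|lborel. f (s + t)) = (LINT t|lborel. f t)"
    for f :: "real \<Rightarrow> 'b::{banach, second_countable_topology}" and s :: real
    using lborel_integral_real_affine[of 1 f s] by simp
  \<comment> \<open>The shear translates each row, so the row integrals of the norm are unchanged
    and the bounds for \<open>H\<close> carry over.\<close>
  have int_H': "integrable (lborel \<Otimes>\<^sub>M lborel) (\<lambda>(s, t). H s (s + t))"
  proof (rule lborel_pair.Fubini_integrable)
    show "integrable lborel (\<lambda>s. LINT t|lborel. norm (case (s, t) of (s, t) \<Rightarrow> H s (s + t)))"
      unfolding prod.case shift[of "\<lambda>t. norm (H s t)" s for s] by (rule outer)
    show "AE s in lborel. integrable lborel (\<lambda>t. case (s, t) of (s, t) \<Rightarrow> H s (s + t))"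
      using row
    proof eventually_elim
      case (elim s)
      then show ?case
        using lborel_integrable_real_affine[of "H s" 1 s] by simp
    qed
  qed (unfold H_def, measurable)
  have "(LINT t|lborel. Phi_op k \<phi> u t * cnj (u t)) = (LINT t|lborel. LINT s|lborel. H s (s + t))"
  proof (rule Bochner_Integration.integral_cong[OF refl])
    fix t
    \<comment> \<open>Off \<open>{0..1}\<close> both sides vanish, since \<open>H s (s + t)\<close>
      contains the factor \<open>u t\<close>.\<close>
    show "Phi_op k \<phi> u t * cnj (u t) = (LINT s|lborel. H s (s + t))"
    proof (cases "t \<in> {0..1}")
      case True
      have "Phi_op k \<phi> u t * cnj (u t)
          = (LINT s|lborel. (cnj (k s (s + t)) * \<phi> (s + t) * cnj (u s)) * cnj (u t))"
        unfolding Phi_op_eq[OF u True] by (rule integral_mult_left_zero[symmetric])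
      also have "\<dots> = (LINT s|lborel. H s (s + t))"
        by (simp add: H_def mult_ac)
      finally show ?thesis .
    qed (use L2_outside[OF u] in \<open>simp add: H_def\<close>)
  qed
  also have "\<dots> = (LINT s|lborel. LINT t|lborel. H s (s + t))"
    by (rule lborel_pair.Fubini_integral[OF int_H'])
  also have "\<dots> = (LINT s|lborel. LINT t|lborel. H s t)"
    by (rule Bochner_Integration.integral_cong[OF refl]) (rule shift)
  also have "\<dots> = (LINT t|lborel. LINT s|lborel. H s t)"
    by (rule lborel_pair.Fubini_integral[OF int_H, symmetric])
  also have "\<dots> = (LINT t|lborel. \<phi> t * cnj (autoconv k u t))"
    by (simp add: H_def autoconv_def del: complex_cnj_mult)
  finally show ?thesis
    by (simp add: L2_inner_def)
qed

end

section \<open>The estimates for Tikhonov minimizers\<close>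

lemma autoconv_kernel_bounded:
  assumes "autoconv_kernel k"
  obtains C where "bounded_kernel k C"
proof -
  obtain C where C: "AE (s, t) in lborel. norm (k s t) \<le> C"
    using assms by (auto simp: autoconv_kernel_def)
  \<comment> \<open>The absolute value provides the sign demanded by
    \<open>bound_nonneg\<close>.\<close>
  have "bounded_kernel k \<bar>C\<bar>"
  proof
    show "AE (s, t) in lborel. norm (k s t) \<le> \<bar>C\<bar>"
      using C by eventually_elim auto
  qed (use assms in \<open>auto simp: autoconv_kernel_def\<close>)
  then show thesis by (rule that)
qed

theorem corollary5p12:
  fixes k :: "real \<Rightarrow> real \<Rightarrow> complex"
    and g gd u\<^sub>0 \<phi> u\<^sub>\<alpha> :: "real \<Rightarrow> complex"
    and \<alpha> \<delta> :: real
  assumes "autoconv_kernel k"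
    and "g \<in> L2 {0..2}" and "gd \<in> L2 {0..2}"
    and "L2_norm (gd - g) \<le> \<delta>"
    and "\<alpha> > 0"
    and "norm_minimizing_solution k g u\<^sub>0"
    and "\<phi> \<in> L2 {0..2}"
    and "L2_onorm {0..1} (Phi_op k \<phi>) = 1"
    and "Phi_op k \<phi> u\<^sub>0 =\<^sub>L u\<^sub>0"
    and "is_arg_min (tikhonov k gd \<alpha>) (\<lambda>u. u \<in> L2 {0..1}) u\<^sub>\<alpha>"
  shows "dilinear_bregman (\<lambda>u. (L2_norm u)\<^sup>2) (\<lambda>_. 0) (Phi_op k \<phi>) u\<^sub>\<alpha> u\<^sub>0
           \<le> (\<delta> / sqrt \<alpha> + sqrt \<alpha> / 2 * L2_norm \<phi>)\<^sup>2
       \<and> L2_norm (autoconv k u\<^sub>\<alpha> - gd) \<le> \<delta> + \<alpha> * L2_norm \<phi>"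
proof -
  obtain C where "bounded_kernel k C"
    using autoconv_kernel_bounded[OF assms(1)] .
  then interpret bounded_kernel k C .
  note \<phi> = assms(7)
  let ?A = "autoconv k" and ?\<Phi> = "Phi_op k \<phi>"
  have u0: "u\<^sub>0 \<in> L2 {0..1}" and sol: "AE t in lborel. ?A u\<^sub>0 t = g t"
    using assms(6) by (auto simp: norm_minimizing_solution_def is_arg_min_def L2_eq_def)
  have ua: "u\<^sub>\<alpha> \<in> L2 {0..1}" and min: "tikhonov k gd \<alpha> u\<^sub>\<alpha> \<le> tikhonov k gd \<alpha> u\<^sub>0"
    using assms(10) u0 by (auto simp: is_arg_min_linorder)
  note Aua = autoconv_L2[OF ua] and Au0 = autoconv_L2[OF u0]
  have meas: "gd - g \<in> borel_measurable borel" "?A u\<^sub>0 - gd \<in> borel_measurable borel"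
    using L2_diff[OF assms(3,2)] L2_diff[OF Au0 assms(3)] by (auto dest: borel_measurable_L2)
  define r p where "r = L2_norm (?A u\<^sub>\<alpha> - gd)" and "p = L2_norm \<phi>"
  define D where "D = dilinear_bregman (\<lambda>u. (L2_norm u)\<^sup>2) (\<lambda>_. 0) ?\<Phi> u\<^sub>\<alpha> u\<^sub>0"
  have r: "0 \<le> r" and p: "0 \<le> p"
    by (simp_all add: r_def p_def L2_norm_nonneg)
  have \<delta>: "0 \<le> \<delta>"
    using assms(4) L2_norm_nonneg[of "gd - g"] by linarith
  have D: "D = (L2_norm u\<^sub>\<alpha>)\<^sup>2 - (L2_norm u\<^sub>0)\<^sup>2 - (L2_inner (?\<Phi> u\<^sub>\<alpha>) u\<^sub>\<alpha> - L2_inner (?\<Phi> u\<^sub>0) u\<^sub>0)"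
    by (simp add: D_def dilinear_bregman_def L2_inner_def)

  \<comment> \<open>As \<open>u\<^sub>0\<close> solves the equation up to a null set, its residual
    is the noise \<open>gd - g\<close> up to sign.\<close>
  have "L2_norm (?A u\<^sub>0 - gd) = L2_norm (gd - g)"
    using meas sol by (intro L2_norm_cong_AE) (auto elim!: eventually_mono simp: norm_minus_commute)
  then have "(L2_norm (?A u\<^sub>0 - gd))\<^sup>2 \<le> \<delta>\<^sup>2"
    using assms(4) by (simp add: L2_norm_nonneg power_mono)
  then have tik: "r\<^sup>2 + \<alpha> * (L2_norm u\<^sub>\<alpha>)\<^sup>2 \<le> \<delta>\<^sup>2 + \<alpha> * (L2_norm u\<^sub>0)\<^sup>2"
    using min by (simp add: tikhonov_def r_def)

  \<comment> \<open>By duality the quadratic forms differ by the pairing of \<open>\<phi>\<close>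
    with \<open>?A u\<^sub>\<alpha> - g\<close>. Splitting this at \<open>gd\<close> leaves pieces
    of norm \<open>r\<close> and at most \<open>\<delta>\<close>.\<close>
  have "L2_inner \<phi> (?A u\<^sub>0) = L2_inner \<phi> g"
    using borel_measurable_L2[OF \<phi>] borel_measurable_L2[OF Au0] borel_measurable_L2[OF assms(2)] sol
    unfolding L2_inner_def
    by (intro arg_cong[where f = Re] integral_cong_AE) (auto elim: eventually_mono)
  then have "L2_inner (?\<Phi> u\<^sub>\<alpha>) u\<^sub>\<alpha> - L2_inner (?\<Phi> u\<^sub>0) u\<^sub>0
      = L2_inner \<phi> (?A u\<^sub>\<alpha> - gd) + L2_inner \<phi> (gd - g)"
    using L2_inner_diff_right[OF \<phi> Aua assms(3)] L2_inner_diff_right[OF \<phi> assms(3,2)]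
    by (simp add: L2_inner_Phi_op[OF _ \<phi>] ua u0)
  moreover have "\<bar>L2_inner \<phi> (?A u\<^sub>\<alpha> - gd)\<bar> \<le> p * r"
    using L2_inner_le_norm[OF \<phi> L2_diff[OF Aua assms(3)]] by (simp add: p_def r_def)
  moreover have "\<bar>L2_inner \<phi> (gd - g)\<bar> \<le> p * \<delta>"
    using L2_inner_le_norm[OF \<phi> L2_diff[OF assms(3,2)]] mult_left_mono[OF assms(4) p]
    by (simp add: p_def)
  ultimately have "D \<le> (L2_norm u\<^sub>\<alpha>)\<^sup>2 - (L2_norm u\<^sub>0)\<^sup>2 + (p * r + p * \<delta>)"
    unfolding D by linarith
  then have "\<alpha> * D \<le> \<alpha> * ((L2_norm u\<^sub>\<alpha>)\<^sup>2 - (L2_norm u\<^sub>0)\<^sup>2 + (p * r + p * \<delta>))"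
    using assms(5) by (intro mult_left_mono) auto
  then have "\<alpha> * D \<le> \<delta>\<^sup>2 - r\<^sup>2 + \<alpha> * p * (r + \<delta>)"
    using tik by (simp add: algebra_simps)
  \<comment> \<open>The square is completed in \<open>\<delta>\<close> and in \<open>r\<close>
    separately; the two corrections \<open>(\<alpha> * p / 2)\<^sup>2\<close> cancel.\<close>
  also have "\<dots> = (\<delta> + \<alpha> * p / 2)\<^sup>2 - (r - \<alpha> * p / 2)\<^sup>2"
    by (simp add: power2_eq_square field_simps)
  finally have key: "\<alpha> * D \<le> (\<delta> + \<alpha> * p / 2)\<^sup>2 - (r - \<alpha> * p / 2)\<^sup>2" .

  \<comment> \<open>Moving \<open>\<alpha>\<close> into the square as \<open>sqrt \<alpha>\<close>
    turns the claimed bound into the first square of \<open>key\<close>.\<close>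
  have "\<alpha> * (\<delta> / sqrt \<alpha> + sqrt \<alpha> / 2 * p)\<^sup>2 = (sqrt \<alpha> * (\<delta> / sqrt \<alpha> + sqrt \<alpha> / 2 * p))\<^sup>2"
    using assms(5) by (simp add: power_mult_distrib)
  also have "sqrt \<alpha> * (\<delta> / sqrt \<alpha> + sqrt \<alpha> / 2 * p) = \<delta> + \<alpha> * p / 2"
    using assms(5) by (simp add: distrib_left flip: mult.assoc)
  finally have "\<alpha> * D \<le> \<alpha> * (\<delta> / sqrt \<alpha> + sqrt \<alpha> / 2 * p)\<^sup>2"
    using key zero_le_power2[of "r - \<alpha> * p / 2"] by linarith
  then have first: "D \<le> (\<delta> / sqrt \<alpha> + sqrt \<alpha> / 2 * p)\<^sup>2"
    using assms(5) by simp

  \<comment> \<open>Since \<open>?\<Phi>\<close> fixes \<open>u\<^sub>0\<close>, the terms in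
    \<open>u\<^sub>0\<close> cancel in \<open>D\<close>. What is left is the squared norm of
    \<open>u\<^sub>\<alpha>\<close> minus the quadratic form there, nonnegative by operator norm
    one.\<close>
  have "L2_inner (?\<Phi> u\<^sub>0) u\<^sub>0 = L2_inner u\<^sub>0 u\<^sub>0"
    using borel_measurable_L2[OF Phi_op_L2[OF u0 \<phi>]] borel_measurable_L2[OF u0] assms(9)
    unfolding L2_inner_def L2_eq_def
    by (intro arg_cong[where f = Re] integral_cong_AE) (auto elim: eventually_mono)
  moreover have "L2_inner (?\<Phi> u\<^sub>\<alpha>) u\<^sub>\<alpha> \<le> L2_norm (?\<Phi> u\<^sub>\<alpha>) * L2_norm u\<^sub>\<alpha>"
    using L2_inner_le_norm[OF Phi_op_L2[OF ua \<phi>] ua] by linarith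
  moreover have "L2_norm (?\<Phi> u\<^sub>\<alpha>) * L2_norm u\<^sub>\<alpha> \<le> (L2_norm u\<^sub>\<alpha>)\<^sup>2"
    using L2_norm_Phi_op_le[OF ua \<phi>] assms(8)
    by (simp add: power2_eq_square mult_right_mono L2_norm_nonneg)
  ultimately have "0 \<le> D"
    unfolding D by (simp add: L2_inner_self)
  then have "0 \<le> \<alpha> * D"
    using assms(5) by simp
  with key have "(r - \<alpha> * p / 2)\<^sup>2 \<le> (\<delta> + \<alpha> * p / 2)\<^sup>2"
    by linarith
  \<comment> \<open>The left side may be negative; comparing squares is still conclusive because the
    right side is nonnegative.\<close>
  then have "r - \<alpha> * p / 2 \<le> \<delta> + \<alpha> * p / 2"
    by (rule power2_le_imp_le) (use \<delta> p assms(5) in simp)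
  then show ?thesis
    using first by (simp add: D_def r_def p_def)
qed

end
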